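(* For a closed $n$-gon (that is, when the monodromy matrix satisfies $M_n=\mathrm{Id}$), one has $$\sum_{j=0}^k I_j=\sum_{j=0}^k J_j=3,\qquad \sum_{j=0}^k w(j)\,I_j=\sum_{j=0}^k w(j)\,J_j=0,\qquad \sum_{j=0}^k w(j)^2\,(I_j-J_j)=0,$$ where $k=[n/2]$ and $w(j)=3j-k$ if $n=2k$, $w(j)=3j-k+1$ if $n=2k+1$.
   Context: Let $n\ge3$ and let $a_0,\dots,a_{n-1},b_0,\dots,b_{n-1}$ be real numbers, extended to $n$-periodic sequences. They encode a twisted $n$-gon in $\mathbb{RP}^2$ via the recurrence $V_{i+3}=a_iV_{i+2}+b_iV_{i+1}+V_i$, $V_i\in\mathbb{R}^3$ (with $V_0,V_1,V_2$ linearly independent), the vertices being the projections of the $V_i$ to $\mathbb{RP}^2$. The monodromy matrix is $$M_n=N_0N_1\cdots N_{n-1},\qquad N_j=\begin{pmatrix}0&0&1\\1&0&b_j\\0&1&a_j\end{pmatrix},$$ so $\det M_n=1$ and the entries of $M_n$ are polynomials in the $a_i,b_i$. The closed $n$-gons are characterized by the condition $M_n=\mathrm{Id}$. Consider the rescaling $\varphi_\tau: a_i\mapsto e^{\tau}a_i,\ b_i\mapsto e^{-\tau}b_i$. The polynomials $I_j$, $j=0,\dots,k$, $k=[n/2]$, are the homogeneous components of $\mathrm{tr}\,M_n$ with respect to this rescaling: $\mathrm{tr}\,M_n=\sum_{j=0}^kI_j$ with $I_j\circ\varphi_\tau=e^{\tau w(j)}I_j$. Similarly $J_j$, $j=0,\dots,k$,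 are the homogeneous components of $\mathrm{tr}\,M_n^{-1}$: $\mathrm{tr}\,M_n^{-1}=\sum_{j=0}^kJ_j$ with $J_j\circ\varphi_\tau=e^{-\tau w(j)}J_j$. *)

theory Defs
  imports "HOL-Analysis.Analysis" "HOL-Library.Poly_Mapping"
begin

definition step_matrix :: "'r \<Rightarrow> 'r \<Rightarrow> 'r::semiring_1^3^3" where
  "step_matrix a b = vector [vector [0, 0, 1], vector [1, 0, b], vector [0, 1, a]]"

text \<open>
  The monodromy is defined over any semiring, so that the same definition gives the real
  matrix of a twisted polygon and the generic matrix over the polynomial ring in the
  coordinates.
\<close>

primrec monodromy :: "nat \<Rightarrow> (nat \<Rightarrow> 'r) \<Rightarrow> (nat \<Rightarrow> 'r) \<Rightarrow> 'r::semiring_1^3^3" where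
  "monodromy 0 a b = mat 1"
| "monodromy (Suc n) a b = monodromy n a b ** step_matrix (a n) (b n)"


text \<open>
  Real polynomials in the coordinates: finitely supported maps from monomials (exponent
  vectors) to coefficients, with the convolution product of \<^theory>\<open>HOL-Library.Poly_Mapping\<close>.
\<close>

datatype coord = Coord_a nat | Coord_b nat

type_synonym monomial = "coord \<Rightarrow>\<^sub>0 nat"
type_synonym coord_poly = "monomial \<Rightarrow>\<^sub>0 real"

definition pvar :: "coord \<Rightarrow> coord_poly" where
  "pvar v = Poly_Mapping.single (Poly_Mapping.single v 1) 1"

primrec coord_val :: "(nat \<Rightarrow> real) \<Rightarrow> (nat \<Rightarrow> real) \<Rightarrow> coord \<Rightarrow> real" where
  "coord_val a b (Coord_a i) = a i"
| "coord_val a b (Coord_b i) = b i"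

definition eval_monomial :: "(nat \<Rightarrow> real) \<Rightarrow> (nat \<Rightarrow> real) \<Rightarrow> monomial \<Rightarrow> real" where
  "eval_monomial a b m = (\<Prod>v\<in>Poly_Mapping.keys m. coord_val a b v ^ Poly_Mapping.lookup m v)"

definition eval_poly :: "(nat \<Rightarrow> real) \<Rightarrow> (nat \<Rightarrow> real) \<Rightarrow> coord_poly \<Rightarrow> real" where
  "eval_poly a b p = (\<Sum>m\<in>Poly_Mapping.keys p. Poly_Mapping.lookup p m * eval_monomial a b m)"


text \<open>
  Under the rescaling \<open>a\<^sub>i \<mapsto> e\<^sup>\<tau> a\<^sub>i\<close>, \<open>b\<^sub>i \<mapsto> e\<^sup>-\<^sup>\<tau> b\<^sub>i\<close> a monomial is multiplied by
  \<open>e\<close> to the power \<open>\<tau>\<close> times its weight, where each \<open>a\<^sub>i\<close> has weight \<open>1\<close> and each \<open>b\<^sub>i\<close>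
  weight \<open>-1\<close>; see \<open>homogeneous_component_rescale\<close> below.
\<close>

primrec coord_weight :: "coord \<Rightarrow> int" where
  "coord_weight (Coord_a i) = 1"
| "coord_weight (Coord_b i) = - 1"

definition weight :: "monomial \<Rightarrow> int" where
  "weight m = (\<Sum>v\<in>Poly_Mapping.keys m. coord_weight v * int (Poly_Mapping.lookup m v))"

definition homogeneous_component :: "int \<Rightarrow> coord_poly \<Rightarrow> coord_poly" where
  "homogeneous_component d p =
     (\<Sum>m\<in>{m \<in> Poly_Mapping.keys p. weight m = d}. Poly_Mapping.single m (Poly_Mapping.lookup p m))"

lemma lookup_homogeneous_component:
  "Poly_Mapping.lookup (homogeneous_component d p) m = (if weight m = d then Poly_Mapping.lookup p m else 0)"
  by (auto simp: homogeneous_component_def lookup_sum lookup_single when_def sum.delta' in_keys_iff)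

lemma keys_homogeneous_component:
  "Poly_Mapping.keys (homogeneous_component d p) = {m \<in> Poly_Mapping.keys p. weight m = d}"
  by (auto simp: in_keys_iff lookup_homogeneous_component split: if_splits)

lemma sum_homogeneous_components:
  "p = (\<Sum>d\<in>weight ` Poly_Mapping.keys p. homogeneous_component d p)"
  by (rule poly_mapping_eqI)
     (auto simp: lookup_sum lookup_homogeneous_component sum.delta in_keys_iff)

lemma eval_monomial_rescale:
  "eval_monomial (\<lambda>i. exp \<tau> * a i) (\<lambda>i. exp (- \<tau>) * b i) m =
     exp (\<tau> * of_int (weight m)) * eval_monomial a b m"
proof -
  have "coord_val (\<lambda>i. exp \<tau> * a i) (\<lambda>i. exp (- \<tau>) * b i) v ^ k =
      exp (\<tau> * of_int (coord_weight v * int k)) * coord_val a b v ^ k" for v k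
    by (cases v) (simp_all add: power_mult_distrib flip: exp_of_nat2_mult)
  then show ?thesis
    by (simp add: eval_monomial_def weight_def prod.distrib sum_distrib_left exp_sum)
qed

lemma homogeneous_component_rescale:
  "eval_poly (\<lambda>i. exp \<tau> * a i) (\<lambda>i. exp (- \<tau>) * b i) (homogeneous_component d p) =
     exp (\<tau> * of_int d) * eval_poly a b (homogeneous_component d p)"
  by (simp add: eval_poly_def keys_homogeneous_component eval_monomial_rescale sum_distrib_left
      mult.left_commute)


definition generic_monodromy :: "nat \<Rightarrow> coord_poly^3^3" where
  "generic_monodromy n = monodromy n (\<lambda>i. pvar (Coord_a i)) (\<lambda>i. pvar (Coord_b i))"

text \<open>The generic monodromy is invertible over the polynomial ring, so its \<open>matrix_inv\<close> is
  a genuine inverse.\<close>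

lemma invertible_step_matrix: "invertible (step_matrix a (b :: 'r::comm_ring_1))"
proof -
  let ?B = "vector [vector [- b, 1, 0], vector [- a, 0, 1], vector [1, 0, 0]] :: 'r^3^3"
  have "step_matrix a b ** ?B = mat 1" "?B ** step_matrix a b = mat 1"
    by (simp_all add: step_matrix_def matrix_matrix_mult_def mat_def vec_eq_iff sum_3 forall_3)
  then show ?thesis
    unfolding invertible_def by blast
qed

lemma invertible_generic_monodromy: "invertible (generic_monodromy n)"
proof -
  have "invertible (monodromy n a b)" for a b :: "nat \<Rightarrow> coord_poly"
  proof (induction n)
    case 0
    show ?case by (auto simp: invertible_def intro: exI[of _ "mat 1"])
  next
    case (Suc n)
    then show ?case by (simp add: invertible_mult invertible_step_matrix)
  qed
  then show ?thesis by (simp add: generic_monodromy_def)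
qed

definition w :: "nat \<Rightarrow> nat \<Rightarrow> int" where
  "w n j = (if even n then 3 * int j - int (n div 2) else 3 * int j - int (n div 2) + 1)"

definition I_poly :: "nat \<Rightarrow> nat \<Rightarrow> coord_poly" where
  "I_poly n j = homogeneous_component (w n j) (trace (generic_monodromy n))"

definition J_poly :: "nat \<Rightarrow> nat \<Rightarrow> coord_poly" where
  "J_poly n j = homogeneous_component (- w n j) (trace (matrix_inv (generic_monodromy n)))"

end

theory Submission
  imports Defs
begin

text \<open>
  Let \<open>M(\<tau>)\<close> be the rescaled monodromy, so \<open>M(0) = 1\<close> and \<open>det M(\<tau>) = 1\<close>. The weighted sums
  of the \<open>I\<^sub>j\<close> and, up to sign, of the \<open>J\<^sub>j\<close> are the derivatives at \<open>\<tau> = 0\<close> of \<open>f = tr M(\<tau>)\<close> and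
  \<open>g = tr M(\<tau>)\<^sup>-\<^sup>1\<close>. As \<open>det M = 1\<close>, the characteristic polynomial at \<open>1\<close> gives
  \<open>g - f = det (1 - M(\<tau>))\<close>, a sum of triple products of functions vanishing at \<open>0\<close>, so \<open>f\<close>
  and \<open>g\<close> agree to second order. Finally \<open>f'(0)\<close> is the derivative of \<open>det M(\<tau>)\<close> at \<open>0\<close>, that is \<open>0\<close>.
\<close>

section \<open>Weighted evaluation of polynomials\<close>

definition weighted_eval :: "(nat \<Rightarrow> real) \<Rightarrow> (nat \<Rightarrow> real) \<Rightarrow> nat \<Rightarrow> coord_poly \<Rightarrow> real" where
  "weighted_eval a b r p =
     (\<Sum>m\<in>Poly_Mapping.keys p. Poly_Mapping.lookup p m * (of_int (weight m) ^ r * eval_monomial a b m))"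

lemma eval_poly_eq_weighted_eval: "eval_poly a b p = weighted_eval a b 0 p"
  by (simp add: eval_poly_def weighted_eval_def)

lemma eval_monomial_superset:
  assumes "finite A" "Poly_Mapping.keys m \<subseteq> A"
  shows "eval_monomial a b m = (\<Prod>v\<in>A. coord_val a b v ^ Poly_Mapping.lookup m v)"
  unfolding eval_monomial_def using assms
  by (intro prod.mono_neutral_left) (auto simp: in_keys_iff)

lemma eval_monomial_add: "eval_monomial a b (l + m) = eval_monomial a b l * eval_monomial a b m"
proof -
  let ?A = "Poly_Mapping.keys l \<union> Poly_Mapping.keys m"
  have "finite ?A" "Poly_Mapping.keys (l + m) \<subseteq> ?A"
    by (simp_all add: Poly_Mapping.keys_add)
  then show ?thesis
    by (simp add: eval_monomial_superset[of ?A] lookup_add power_add prod.distrib)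
qed

lemma weight_superset:
  assumes "finite A" "Poly_Mapping.keys m \<subseteq> A"
  shows "weight m = (\<Sum>v\<in>A. coord_weight v * int (Poly_Mapping.lookup m v))"
  unfolding weight_def using assms
  by (intro sum.mono_neutral_left) (auto simp: in_keys_iff)

lemma weight_add: "weight (l + m) = weight l + weight m"
proof -
  let ?A = "Poly_Mapping.keys l \<union> Poly_Mapping.keys m"
  have "finite ?A" "Poly_Mapping.keys (l + m) \<subseteq> ?A"
    by (simp_all add: Poly_Mapping.keys_add)
  then show ?thesis
    by (simp add: weight_superset[of ?A] lookup_add distrib_left sum.distrib)
qed

lemma weight_zero [simp]: "weight 0 = 0"
  by (simp add: weight_def)

lemma weighted_eval_superset:
  assumes "finite A" "Poly_Mapping.keys p \<subseteq> A"
  shows "weighted_eval a b r p =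
     (\<Sum>m\<in>A. Poly_Mapping.lookup p m * (of_int (weight m) ^ r * eval_monomial a b m))"
  unfolding weighted_eval_def using assms
  by (intro sum.mono_neutral_left) (auto simp: in_keys_iff)

lemma weighted_eval_add:
  "weighted_eval a b r (p + q) = weighted_eval a b r p + weighted_eval a b r q"
proof -
  let ?A = "Poly_Mapping.keys p \<union> Poly_Mapping.keys q"
  have "finite ?A" "Poly_Mapping.keys (p + q) \<subseteq> ?A"
    by (simp_all add: Poly_Mapping.keys_add)
  then show ?thesis
    by (simp add: weighted_eval_superset[of ?A] lookup_add distrib_right sum.distrib)
qed

lemma weighted_eval_zero [simp]: "weighted_eval a b r 0 = 0"
  by (simp add: weighted_eval_def)

lemma weighted_eval_uminus: "weighted_eval a b r (- p) = - weighted_eval a b r p"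
  using weighted_eval_add[of a b r p "- p"] by simp

lemma weighted_eval_diff:
  "weighted_eval a b r (p - q) = weighted_eval a b r p - weighted_eval a b r q"
  using weighted_eval_add[of a b r p "- q"] by (simp add: weighted_eval_uminus)

lemma weighted_eval_sum:
  "weighted_eval a b r (\<Sum>i\<in>A. f i) = (\<Sum>i\<in>A. weighted_eval a b r (f i))"
  by (induction A rule: infinite_finite_induct) (simp_all add: weighted_eval_add)

lemma weighted_eval_single:
  "weighted_eval a b r (Poly_Mapping.single m c) = c * (of_int (weight m) ^ r * eval_monomial a b m)"
  by (simp add: weighted_eval_def)

lemma weighted_eval_one: "weighted_eval a b r 1 = (if r = 0 then 1 else 0)"
  using weighted_eval_single[of a b r 0 1] by (simp add: eval_monomial_def)

lemma poly_mapping_eq_sum_single: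
  "p = (\<Sum>m\<in>Poly_Mapping.keys p. Poly_Mapping.single m (Poly_Mapping.lookup p m))"
  by (rule poly_mapping_eqI) (auto simp: lookup_sum lookup_single when_def sum.delta' in_keys_iff)

text \<open>Weights of monomials add and their values multiply, so this is the binomial theorem for
  \<open>(weight l + weight m) ^ r\<close>.\<close>

lemma weighted_eval_mult_single:
  "weighted_eval a b r (Poly_Mapping.single l c * Poly_Mapping.single m d) =
    (\<Sum>i\<le>r. of_nat (r choose i) * weighted_eval a b i (Poly_Mapping.single l c)
       * weighted_eval a b (r - i) (Poly_Mapping.single m d))"
  by (simp add: mult_single weighted_eval_single weight_add eval_monomial_add binomial_ring
      sum_distrib_left sum_distrib_right mult_ac)

text \<open>\<open>weighted_eval a b r p\<close> is the \<open>r\<close>-th derivative at \<open>\<tau> = 0\<close> of the evaluation of \<open>p\<close>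
  at the rescaled coordinates, whence a Leibniz rule.\<close>

lemma weighted_eval_mult:
  "weighted_eval a b r (p * q) =
    (\<Sum>i\<le>r. of_nat (r choose i) * weighted_eval a b i p * weighted_eval a b (r - i) q)"
proof -
  let ?s = "\<lambda>p m. Poly_Mapping.single m (Poly_Mapping.lookup p m) :: coord_poly"
  let ?K = "Poly_Mapping.keys :: coord_poly \<Rightarrow> monomial set"
  have "weighted_eval a b r (p * q) = weighted_eval a b r ((\<Sum>l\<in>?K p. ?s p l) * (\<Sum>m\<in>?K q. ?s q m))"
    using poly_mapping_eq_sum_single[of p] poly_mapping_eq_sum_single[of q] by simp
  also have "\<dots> = (\<Sum>l\<in>?K p. \<Sum>m\<in>?K q. weighted_eval a b r (?s p l * ?s q m))"
    by (simp only: sum_product weighted_eval_sum)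
  also have "\<dots> = (\<Sum>l\<in>?K p. \<Sum>m\<in>?K q. \<Sum>i\<le>r. of_nat (r choose i)
      * weighted_eval a b i (?s p l) * weighted_eval a b (r - i) (?s q m))"
    by (simp only: weighted_eval_mult_single)
  also have "\<dots> = (\<Sum>l\<in>?K p. \<Sum>i\<le>r. \<Sum>m\<in>?K q. of_nat (r choose i)
      * weighted_eval a b i (?s p l) * weighted_eval a b (r - i) (?s q m))"
    by (intro sum.cong refl sum.swap)
  also have "\<dots> = (\<Sum>i\<le>r. \<Sum>l\<in>?K p. \<Sum>m\<in>?K q. of_nat (r choose i)
      * weighted_eval a b i (?s p l) * weighted_eval a b (r - i) (?s q m))"
    by (rule sum.swap)
  also have "\<dots> = (\<Sum>i\<le>r. of_nat (r choose i) * weighted_eval a b i (\<Sum>l\<in>?K p. ?s p l)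
      * weighted_eval a b (r - i) (\<Sum>m\<in>?K q. ?s q m))"
    by (simp only: weighted_eval_sum sum_product mult.assoc) (simp only: sum_distrib_left)
  finally show ?thesis
    by (simp only: poly_mapping_eq_sum_single[symmetric])
qed

lemma weighted_eval_0_mult:
  "weighted_eval a b 0 (p * q) = weighted_eval a b 0 p * weighted_eval a b 0 q"
  by (simp add: weighted_eval_mult)

lemma weighted_eval_1_mult:
  "weighted_eval a b (Suc 0) (p * q) =
     weighted_eval a b 0 p * weighted_eval a b (Suc 0) q + weighted_eval a b (Suc 0) p * weighted_eval a b 0 q"
  by (simp add: weighted_eval_mult)

text \<open>At most two derivatives fall on three factors, so every Leibniz term keeps an
  undifferentiated factor, which is \<open>0\<close>.\<close>

lemma weighted_eval_triple_vanishing: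
  assumes "r \<le> 2"
    and "weighted_eval a b 0 p = 0" "weighted_eval a b 0 q = 0" "weighted_eval a b 0 s = 0"
  shows "weighted_eval a b r (p * q * s) = 0"
proof -
  have "r = 0 \<or> r = Suc 0 \<or> r = Suc (Suc 0)"
    using assms(1) by auto
  then show ?thesis
    using assms(2-) by (auto simp: weighted_eval_mult)
qed

lemma eval_poly_homogeneous_component:
  "eval_poly a b (homogeneous_component d p) =
     (\<Sum>m\<in>{m \<in> Poly_Mapping.keys p. weight m = d}. Poly_Mapping.lookup p m * eval_monomial a b m)"
  by (simp add: eval_poly_def keys_homogeneous_component lookup_homogeneous_component)

text \<open>Monomials are grouped by weight. \<open>D\<close> may contain weights that do not occur;
  this allows summing over all values of \<open>w\<close>.\<close>

lemma weighted_eval_eq_sum_homogeneous_components: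
  assumes "finite D" "weight ` Poly_Mapping.keys p \<subseteq> D"
  shows "weighted_eval a b r p = (\<Sum>d\<in>D. of_int d ^ r * eval_poly a b (homogeneous_component d p))"
proof -
  have "weighted_eval a b r p = (\<Sum>d\<in>D. \<Sum>m\<in>{m \<in> Poly_Mapping.keys p. weight m = d}.
      Poly_Mapping.lookup p m * (of_int (weight m) ^ r * eval_monomial a b m))"
    unfolding weighted_eval_def using assms by (intro sum.group[symmetric]) auto
  also have "\<dots> = (\<Sum>d\<in>D. of_int d ^ r * eval_poly a b (homogeneous_component d p))"
    by (intro sum.cong refl) (simp add: eval_poly_homogeneous_component sum_distrib_left mult_ac)
  finally show ?thesis .
qed


section \<open>Weights occurring in the monodromy\<close>

text \<open>Weights along a path from \<open>i\<close> to \<open>j\<close> through the step matrices: each step counts \<open>1\<close>, up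
  to the potential \<open>h\<close> and to \<open>s\<close> drops by \<open>3\<close> at the entries \<open>1\<close> and \<open>b\<close> of the last
  column. The potential \<open>g\<close> records that between two drops at least two steps are made.\<close>

definition graded :: "int \<Rightarrow> ('n \<Rightarrow> int) \<Rightarrow> ('n \<Rightarrow> int) \<Rightarrow> nat \<Rightarrow> coord_poly^'n^'n \<Rightarrow> bool" where
  "graded \<sigma> h g n M \<longleftrightarrow> (\<forall>i j. \<forall>m\<in>Poly_Mapping.keys (M $ i $ j).
     \<exists>s::nat. \<sigma> * weight m = int n + h j - h i - 3 * int s \<and> 2 * int s \<le> int n + g j - g i)"

lemma graded_mat_1: "graded \<sigma> h g 0 (mat 1)"
  by (auto simp: graded_def mat_def intro: exI[of _ 0] split: if_splits)

lemma graded_mult: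
  assumes "graded \<sigma> h g n M" "graded \<sigma> h g n' M'"
  shows "graded \<sigma> h g (n + n') (M ** M')"
  unfolding graded_def
proof (intro allI ballI)
  fix i j m
  assume "m \<in> Poly_Mapping.keys ((M ** M') $ i $ j)"
  then obtain k where "m \<in> Poly_Mapping.keys (M $ i $ k * M' $ k $ j)"
    using keys_sum[of "\<lambda>k. M $ i $ k * M' $ k $ j" UNIV] by (auto simp: matrix_matrix_mult_def)
  then obtain x y where m: "m = x + y"
    and x: "x \<in> Poly_Mapping.keys (M $ i $ k)" and y: "y \<in> Poly_Mapping.keys (M' $ k $ j)"
    using keys_mult by blast
  obtain s where s: "\<sigma> * weight x = int n + h k - h i - 3 * int s" "2 * int s \<le> int n + g k - g i"
    using assms(1) x unfolding graded_def by blast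
  obtain t where t: "\<sigma> * weight y = int n' + h j - h k - 3 * int t" "2 * int t \<le> int n' + g j - g k"
    using assms(2) y unfolding graded_def by blast
  show "\<exists>s::nat. \<sigma> * weight m = int (n + n') + h j - h i - 3 * int s
      \<and> 2 * int s \<le> int (n + n') + g j - g i"
    by (rule exI[of _ "s + t"]) (use s t in \<open>simp add: m weight_add distrib_left\<close>)
qed

section \<open>Weights of the step matrices, their products and inverses\<close>

definition step_inverse :: "'r \<Rightarrow> 'r \<Rightarrow> 'r::comm_ring_1^3^3" where
  "step_inverse a b = vector [vector [- b, 1, 0], vector [- a, 0, 1], vector [1, 0, 0]]"

lemma step_matrix_inverse:
  "step_matrix a b ** step_inverse a b = mat 1" "step_inverse a b ** step_matrix a b = mat 1"
  by (simp_all add: step_matrix_def step_inverse_def matrix_matrix_mult_def mat_def vec_eq_iff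
      sum_3 forall_3)

text \<open>\<open>h3 i\<close> is i - 3 for i = 1, 2, 3; it makes every entry of a step matrix have
  weight \<open>1 + h3 j - h3 i\<close> modulo 3.\<close>

definition h3 :: "3 \<Rightarrow> int" where "h3 i = (if i = 1 then -2 else if i = 2 then -1 else 0)"
text \<open>A drop always lands at index 3, and row 3 has no drop; the higher value at 3 encodes
  this delay.\<close>

definition g3 :: "3 \<Rightarrow> int" where "g3 i = (if i = 3 then 0 else -1)"

lemma weight_pvar: "m \<in> Poly_Mapping.keys (pvar v) \<Longrightarrow> weight m = coord_weight v"
  by (simp add: pvar_def weight_def)

lemma graded_step_matrix:
  "graded 1 h3 g3 1 (step_matrix (pvar (Coord_a i)) (pvar (Coord_b i)))"
  unfolding graded_def forall_3 step_matrix_def h3_def g3_def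
  by (auto dest!: weight_pvar intro: exI[of _ 0] exI[of _ 1])

text \<open>Conjugating by the reversal of the basis turns \<open>step_inverse a b\<close> into
  \<open>step_matrix (- b) (- a)\<close>; hence the reversed potentials and the opposite sign.\<close>

lemma graded_step_inverse:
  "graded (- 1) (\<lambda>i. h3 (4 - i)) (\<lambda>i. g3 (4 - i)) 1
     (step_inverse (pvar (Coord_a i)) (pvar (Coord_b i)))"
  unfolding graded_def forall_3 step_inverse_def h3_def g3_def
  by (auto dest!: weight_pvar intro: exI[of _ 0] exI[of _ 1])

lemma graded_generic_monodromy: "graded 1 h3 g3 n (generic_monodromy n)"
  unfolding generic_monodromy_def
proof (induction n)
  case (Suc n)
  then show ?case
    using graded_mult[OF Suc graded_step_matrix] by simp
qed (simp add: graded_mat_1)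

text \<open>\<open>matrix_inv\<close> is defined by choice and shows no entries, so weights are
  tracked on the reversed product of step inverses; uniqueness of inverses then transfers
  them.\<close>

lemma graded_inverse_generic_monodromy:
  "\<exists>M'. generic_monodromy n ** M' = mat 1 \<and> M' ** generic_monodromy n = mat 1
     \<and> graded (- 1) (\<lambda>i. h3 (4 - i)) (\<lambda>i. g3 (4 - i)) n M'"
  unfolding generic_monodromy_def
proof (induction n)
  case 0
  show ?case by (auto intro!: exI[of _ "mat 1"] graded_mat_1)
next
  case (Suc n)
  let ?M = "monodromy n (\<lambda>i. pvar (Coord_a i)) (\<lambda>i. pvar (Coord_b i))"
  let ?N = "step_matrix (pvar (Coord_a n)) (pvar (Coord_b n))"
  let ?N' = "step_inverse (pvar (Coord_a n)) (pvar (Coord_b n))"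
  obtain M' where M': "?M ** M' = mat 1" "M' ** ?M = mat 1"
    "graded (- 1) (\<lambda>i. h3 (4 - i)) (\<lambda>i. g3 (4 - i)) n M'"
    using Suc by blast
  have "(?M ** ?N) ** (?N' ** M') = ?M ** (?N ** ?N') ** M'"
    "(?N' ** M') ** (?M ** ?N) = ?N' ** (M' ** ?M) ** ?N"
    by (simp_all only: matrix_mul_assoc)
  then have "(?M ** ?N) ** (?N' ** M') = mat 1" "(?N' ** M') ** (?M ** ?N) = mat 1"
    by (simp_all add: M' step_matrix_inverse)
  then show ?case
    using graded_mult[OF graded_step_inverse M'(3)] by auto
qed

lemma matrix_inv_eqI:
  fixes A B :: "'a::semiring_1^'n^'n"
  assumes "A ** B = mat 1" "B ** A = mat 1"
  shows "matrix_inv A = B"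
proof -
  have "A ** matrix_inv A = mat 1"
    unfolding matrix_inv_def by (rule someI2[of _ B]) (use assms in auto)
  then have "B ** A ** matrix_inv A = B"
    by (metis matrix_mul_assoc matrix_mul_rid)
  then show ?thesis
    by (simp add: assms)
qed

lemma inverse_generic_monodromy:
  "generic_monodromy n ** matrix_inv (generic_monodromy n) = mat 1"
  "graded (- 1) (\<lambda>i. h3 (4 - i)) (\<lambda>i. g3 (4 - i)) n (matrix_inv (generic_monodromy n))"
  using graded_inverse_generic_monodromy[of n] matrix_inv_eqI by blast+

section \<open>Matching the weights of the traces with the values of \<open>w\<close>\<close>

lemma w_eq: "w n j = int n - 3 * (int (n div 2) - int j)"
proof (cases "even n")
  case False
  then have "n = 2 * (n div 2) + 1" by simp
  then have "int n = 2 * int (n div 2) + 1" by linarith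
  with False show ?thesis by (simp add: w_def)
qed (auto simp: w_def)

text \<open>On the diagonal both potentials cancel, leaving \<open>int n - 3 * int s\<close> with
  \<open>2 * s \<le> n\<close>. By \<open>w_eq\<close> this is \<open>w n j\<close> for j =
  \<open>n div 2 - s\<close>, so the components indexed by 0 to k exhaust the trace.\<close>

lemma graded_trace_weight:
  assumes "graded \<sigma> h g n M" "m \<in> Poly_Mapping.keys (trace M)"
  shows "\<sigma> * weight m \<in> w n ` {0..n div 2}"
proof -
  obtain i where "m \<in> Poly_Mapping.keys (M $ i $ i)"
    using assms(2) keys_sum[of "\<lambda>i. M $ i $ i" UNIV] by (auto simp: trace_def)
  then obtain s :: nat where s: "\<sigma> * weight m = int n - 3 * int s" "2 * int s \<le> int n"
    using assms(1) unfolding graded_def by fastforce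
  then have "s \<le> n div 2" by linarith
  with s have "\<sigma> * weight m = w n (n div 2 - s)"
    by (simp add: w_eq of_nat_diff)
  then show ?thesis by simp
qed

text \<open>The sign \<sigma> is \<open>1\<close> for the \<open>I_poly\<close> and
  \<open>- 1\<close> for the \<open>J_poly\<close>.\<close>

lemma sum_homogeneous_trace:
  assumes "graded \<sigma> h g n M" "\<sigma> * \<sigma> = 1"
  shows "(\<Sum>j=0..n div 2. of_int (w n j) ^ r * eval_poly a b (homogeneous_component (\<sigma> * w n j) (trace M)))
     = of_int \<sigma> ^ r * weighted_eval a b r (trace M)"
proof -
  let ?D = "(\<lambda>j. \<sigma> * w n j) ` {0..n div 2}"
  have "weight ` Poly_Mapping.keys (trace M) \<subseteq> ?D"
  proof
    fix d assume "d \<in> weight ` Poly_Mapping.keys (trace M)"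
    then have "\<sigma> * d \<in> w n ` {0..n div 2}"
      using graded_trace_weight[OF assms(1)] by auto
    then have "\<sigma> * (\<sigma> * d) \<in> ?D" by auto
    then show "d \<in> ?D" by (simp add: assms(2) flip: mult.assoc)
  qed
  then have "weighted_eval a b r (trace M) =
      (\<Sum>d\<in>?D. of_int d ^ r * eval_poly a b (homogeneous_component d (trace M)))"
    by (intro weighted_eval_eq_sum_homogeneous_components) auto
  also have "\<dots> = (\<Sum>j=0..n div 2. of_int (\<sigma> * w n j) ^ r
      * eval_poly a b (homogeneous_component (\<sigma> * w n j) (trace M)))"
  \<comment> \<open>Distinct indices j give distinct weights, so no component is counted
    twice.\<close>
  proof (subst sum.reindex)
    have "\<sigma> \<noteq> 0" using assms(2) by auto
    then show "inj_on (\<lambda>j. \<sigma> * w n j) {0..n div 2}"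
      by (auto simp: inj_on_def w_eq)
  qed simp
  finally have E: "weighted_eval a b r (trace M) = of_int \<sigma> ^ r * (\<Sum>j=0..n div 2. of_int (w n j) ^ r
      * eval_poly a b (homogeneous_component (\<sigma> * w n j) (trace M)))"
    by (simp add: power_mult_distrib sum_distrib_left mult.assoc)
  have "(of_int \<sigma> ^ r * of_int \<sigma> ^ r :: real) = of_int (\<sigma> * \<sigma>) ^ r"
    by (simp add: power_mult_distrib)
  with assms(2) show ?thesis
    by (simp add: E flip: mult.assoc)
qed


section \<open>Closed polygons\<close>

lemma weighted_eval_0_generic_monodromy:
  "weighted_eval a b 0 (generic_monodromy n $ i $ j) = monodromy n a b $ i $ j"
proof -
  have pvar: "weighted_eval a b 0 (pvar v) = coord_val a b v" for v
    by (simp add: pvar_def weighted_eval_single eval_monomial_def)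
  have step: "weighted_eval a b 0 (step_matrix (pvar (Coord_a k)) (pvar (Coord_b k)) $ i $ j)
      = step_matrix (a k) (b k) $ i $ j" for k i j
    using exhaust_3[of i] exhaust_3[of j]
    by (auto simp: step_matrix_def pvar weighted_eval_one)
  show ?thesis
    unfolding generic_monodromy_def
    by (induction n arbitrary: i j)
      (simp_all add: mat_def weighted_eval_one matrix_matrix_mult_def weighted_eval_sum
        weighted_eval_0_mult step)
qed

section \<open>Determinant, trace and inverse of 3 by 3 matrices\<close>

lemma det_step_matrix: "det (step_matrix a (b :: 'r::comm_ring_1)) = 1"
  by (simp add: det_3 step_matrix_def)

lemma det_generic_monodromy: "det (generic_monodromy n) = 1"
  unfolding generic_monodromy_def by (induction n) (simp_all add: det_mul det_step_matrix)

lemma trace_inverse_3: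
  fixes M M' :: "'r::comm_ring_1^3^3"
  assumes "M ** M' = mat 1" "det M = 1"
  shows "trace M' = M$1$1 * M$2$2 - M$1$2 * M$2$1 + (M$1$1 * M$3$3 - M$1$3 * M$3$1)
     + (M$2$2 * M$3$3 - M$2$3 * M$3$2)"
proof -
  \<comment> \<open>\<open>A\<close> is the adjugate of \<open>M\<close>, which is the inverse when
    the determinant is \<open>1\<close>; its trace is the sum of the principal 2 by 2
    minors.\<close>
  define A :: "'r^3^3" where "A = vector [
    vector [M$2$2 * M$3$3 - M$2$3 * M$3$2, M$1$3 * M$3$2 - M$1$2 * M$3$3, M$1$2 * M$2$3 - M$1$3 * M$2$2],
    vector [M$2$3 * M$3$1 - M$2$1 * M$3$3, M$1$1 * M$3$3 - M$1$3 * M$3$1, M$1$3 * M$2$1 - M$1$1 * M$2$3],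
    vector [M$2$1 * M$3$2 - M$2$2 * M$3$1, M$1$2 * M$3$1 - M$1$1 * M$3$2, M$1$1 * M$2$2 - M$1$2 * M$2$1]]"
  have "A ** M = mat (det M)"
    by (simp add: A_def det_3 mat_def matrix_matrix_mult_def vec_eq_iff sum_3 forall_3 algebra_simps)
  then have "A ** (M ** M') = M'"
    by (simp add: matrix_mul_assoc assms(2))
  then have "M' = A"
    by (simp add: assms(1))
  then show ?thesis
    by (simp add: A_def trace_def sum_3 algebra_simps)
qed

lemma trace_inverse_minus_trace:
  fixes M M' :: "'r::comm_ring_1^3^3"
  assumes "M ** M' = mat 1" "det M = 1"
  shows "trace M' - trace M = det (mat 1 - M)"
proof -
  have "det (mat 1 - M) = 1 - trace M + trace M' - det M"
    unfolding trace_inverse_3[OF assms] by (simp add: det_3 trace_def sum_3 mat_def algebra_simps)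
  then show ?thesis
    by (simp add: assms(2))
qed

lemma weighted_eval_det_vanishing:
  assumes "r \<le> 2" "\<And>i j. weighted_eval a b 0 (M $ i $ j) = 0"
  shows "weighted_eval a b r (det (M :: coord_poly^3^3)) = 0"
  by (simp add: det_3 weighted_eval_add weighted_eval_diff weighted_eval_triple_vanishing assms)

text \<open>Jacobi's formula at the identity: each non-diagonal term of the determinant has at least
  two factors vanishing to order zero, so one derivative kills it.\<close>

lemma weighted_eval_1_det:
  assumes "\<And>i j. weighted_eval a b 0 (M $ i $ j) = mat 1 $ i $ j"
  shows "weighted_eval a b (Suc 0) (det (M :: coord_poly^3^3)) = weighted_eval a b (Suc 0) (trace M)"
  by (simp add: det_3 trace_def sum_3 weighted_eval_add weighted_eval_diff weighted_eval_1_mult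
      weighted_eval_0_mult assms mat_def)

theorem theorem4:
  fixes n k :: nat and a b :: "nat \<Rightarrow> real"
  assumes "n \<ge> 3"
    and "k = n div 2"
    and "monodromy n a b = mat 1"
  shows "(\<Sum>j=0..k. eval_poly a b (I_poly n j)) = 3
    \<and> (\<Sum>j=0..k. eval_poly a b (J_poly n j)) = 3
    \<and> (\<Sum>j=0..k. of_int (w n j) * eval_poly a b (I_poly n j)) = 0
    \<and> (\<Sum>j=0..k. of_int (w n j) * eval_poly a b (J_poly n j)) = 0
    \<and> (\<Sum>j=0..k. (of_int (w n j))\<^sup>2 *
          (eval_poly a b (I_poly n j) - eval_poly a b (J_poly n j))) = 0"
proof -
  let ?M = "generic_monodromy n"
  let ?M' = "matrix_inv ?M"
  let ?E = "weighted_eval a b"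
  have I: "(\<Sum>j=0..k. of_int (w n j) ^ r * eval_poly a b (I_poly n j)) = ?E r (trace ?M)" for r
    using sum_homogeneous_trace[OF graded_generic_monodromy, of n r a b]
    by (simp add: I_poly_def assms(2))
  \<comment> \<open>The sign comes from the weights \<open>- w n j\<close>; it is harmless below,
    since the first moment is \<open>0\<close> and the second is even.\<close>
  have J: "(\<Sum>j=0..k. of_int (w n j) ^ r * eval_poly a b (J_poly n j)) = (- 1) ^ r * ?E r (trace ?M')" for r
    using sum_homogeneous_trace[OF inverse_generic_monodromy(2), of n r a b]
    by (simp add: J_poly_def assms(2))
  have M: "?E 0 (?M $ i $ j) = mat 1 $ i $ j" for i j
    by (simp add: weighted_eval_0_generic_monodromy assms(3))
  have "?E 0 ((mat 1 - ?M) $ i $ j) = 0" for i j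
    by (simp add: weighted_eval_diff M) (simp add: mat_def weighted_eval_one)
  then have "?E r (trace ?M' - trace ?M) = 0" if "r \<le> 2" for r
    using that trace_inverse_minus_trace[OF inverse_generic_monodromy(1) det_generic_monodromy]
    by (simp add: weighted_eval_det_vanishing)
  then have eq: "?E r (trace ?M') = ?E r (trace ?M)" if "r \<le> 2" for r
    using that by (simp add: weighted_eval_diff)
  have E0: "?E 0 (trace ?M) = 3"
    by (simp add: trace_def weighted_eval_sum M) (simp add: mat_def)
  \<comment> \<open>The determinant is the constant polynomial \<open>1\<close>, whose first
    derivative is \<open>0\<close>.\<close>
  have E1: "?E (Suc 0) (trace ?M) = 0"
    using weighted_eval_1_det[of a b ?M, OF M]
    by (simp add: det_generic_monodromy weighted_eval_one)
  show ?thesis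
    using I[of 0] J[of 0] I[of 1] J[of 1] I[of 2] J[of 2] eq[of 0] eq[of 1] eq[of 2] E0 E1
    by (simp add: right_diff_distrib sum_subtractf)
qed

end
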